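(* Let $s$ be a positive integer and let $\Delta$ be a lattice simplex of dimension $f(2s)-1$ with $\deg(\Delta)=s$ which is not a lattice pyramid. Then $\Lambda_\Delta\subset\{0,1/2\}^{f(2s)}$, i.e., every coordinate of every element of $\Lambda_\Delta$ is $0$ or $1/2$ modulo $\mathbb{Z}$.
   Context: For a positive integer $M$, $f(M)=\sum_{n\ge0}\lfloor M/2^n\rfloor$. A lattice polytope is a convex polytope in $\mathbb{R}^d$ with vertices in $\mathbb{Z}^d$; unimodular equivalence means $P'=f(P)+u$ with $f\in\mathrm{GL}_d(\mathbb{Z})$, $u\in\mathbb{Z}^d$. $\deg(P)$ is the degree of the $h^*$-polynomial of $P$, where $\sum_{n\ge0}|nP\cap\mathbb{Z}^d|t^n=h^*_P(t)/(1-t)^{d+1}$ for $d=\dim P$. A polytope is a lattice pyramid if it is unimodularly equivalent to $\mathrm{conv}(\{(\alpha,0):\alpha\in Q\}\cup\{(0,\dots,0,1)\})$ for some lower-dimensional lattice polytope $Q$. For a $d$-dimensional lattice simplex $\Delta\subset\mathbb{R}^d$ with vertices $v_1,\dots,v_{d+1}$, $\Lambda_\Delta=\{(x_1,\dots,x_{d+1})\in(\mathbb{R}/\mathbb{Z})^{d+1}:\sum_i x_iv_i\in\mathbb{Z}^d,\ \sum_ix_i\in\mathbb{Z}\}$. *)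

theory Defs
  imports
    "HOL-Analysis.Analysis"
    "HOL-Computational_Algebra.Computational_Algebra"
begin

text \<open>All but finitely many terms of this series vanish, so it converges in the discrete
  topology of \<^typ>\<open>nat\<close>.\<close>

definition floor_sum :: "nat \<Rightarrow> nat" where
  "floor_sum M = (\<Sum>n. M div 2 ^ n)"

definition int_lattice :: "(real ^ 'n) set" where
  "int_lattice = {x. \<forall>i. x $ i \<in> \<int>}"

definition lattice_polytope :: "(real ^ 'n) set \<Rightarrow> bool" where
  "lattice_polytope P \<longleftrightarrow> polytope P \<and> {v. v extreme_point_of P} \<subseteq> int_lattice"

text \<open>Invertibility is over the integers: the inverse of \<open>A\<close> is again an integer matrix, i.e.
  \<open>A\<close> ranges over $\mathrm{GL}_d(\mathbb{Z})$.\<close>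

definition unimodularly_equivalent :: "(real ^ 'n) set \<Rightarrow> (real ^ 'n) set \<Rightarrow> bool" where
  "unimodularly_equivalent P P' \<longleftrightarrow>
     (\<exists>(A :: int ^ 'n ^ 'n) u. invertible A \<and> u \<in> int_lattice \<and>
        P' = (\<lambda>x. map_matrix real_of_int A *v x + u) ` P)"

text \<open>The space $\mathbb{R}^{d-1}$ containing the base \<open>Q\<close> is identified with a coordinate
  hyperplane of \<^typ>\<open>real ^ 'n\<close>. The index type has no distinguished last coordinate, so any
  coordinate \<open>k\<close> may serve as the height; permuting coordinates is unimodular.\<close>

definition lattice_pyramid :: "(real ^ 'n) set \<Rightarrow> bool" where
  "lattice_pyramid P \<longleftrightarrow>
     (\<exists>k Q. lattice_polytope Q \<and> Q \<subseteq> {x. x $ k = 0} \<and>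
        unimodularly_equivalent P (convex hull (Q \<union> {axis k 1})))"

definition ehrhart_series :: "(real ^ 'n) set \<Rightarrow> real fps" where
  "ehrhart_series P =
     Abs_fps (\<lambda>n. real (card ((\<lambda>x. real n *\<^sub>R x) ` P \<inter> int_lattice)))"

text \<open>There is at most one such polynomial, since $1 - t$ is a unit of the ring of formal power
  series; for nonempty lattice polytopes one exists by the theorem of Ehrhart and Stanley.\<close>

definition hstar_poly :: "(real ^ 'n) set \<Rightarrow> real poly" where
  "hstar_poly P = (THE h. ehrhart_series P = fps_of_poly h / (1 - fps_X) ^ (nat (aff_dim P) + 1))"

definition polytope_degree :: "(real ^ 'n) set \<Rightarrow> nat" where
  "polytope_degree P = degree (hstar_poly P)"

quotient_type real_mod_int = real / "\<lambda>x y :: real. x - y \<in> \<int>"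
  morphisms rep_real_mod_int mod_int
proof (intro equivpI reflpI sympI transpI)
  show "x - x \<in> \<int>" for x :: real
    by simp
  show "y - x \<in> \<int>" if "x - y \<in> \<int>" for x y :: real
    using Ints_minus[OF that] by simp
  show "x - z \<in> \<int>" if "x - y \<in> \<int>" "y - z \<in> \<int>" for x y z :: real
    using Ints_add[OF that] by simp
qed

text \<open>Here \<open>v\<close> enumerates the \<open>d + 1\<close> vertices of a simplex in $\mathbb{R}^d$ as
  \<open>v 1, \<dots>, v (d + 1)\<close>. The conditions are stated for a tuple \<open>y\<close> of real representatives of
  \<open>x\<close>; as the vertices are lattice points, they do not depend on the choice of \<open>y\<close>.\<close>

definition Lambda :: "(nat \<Rightarrow> real ^ 'n) \<Rightarrow> (nat \<Rightarrow> real_mod_int) set" where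
  "Lambda v =
     {x \<in> {1..CARD('n) + 1} \<rightarrow>\<^sub>E UNIV.
        \<exists>y. (\<forall>i\<in>{1..CARD('n) + 1}. x i = mod_int (y i)) \<and>
            (\<Sum>i=1..CARD('n) + 1. y i *\<^sub>R v i) \<in> int_lattice \<and>
            (\<Sum>i=1..CARD('n) + 1. y i) \<in> \<int>}"

end

theory Submission imports Defs begin

text \<open>
  Let $G$ be the group of real representatives of the elements of $\Lambda_\Delta$, and let the
  weight of an element be its number of non-integral coordinates. As $h^*_\Delta$ counts the
  points of $G \cap [0,1)^{d+1}$ by their coordinate sum, and the fractional parts of $y$ and $-y$
  add up to the weight of $y$, all weights are at most $M = 2s$; as $\Delta$ is not a pyramid, every
  coordinate is non-integral for some element. If $x$ has maximal weight $m$ and support $S$, then for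
  each coordinate in $S$ at least one of $y$ and $y + x$ is non-integral, so that $y$ has weight at most
  $m/2$ outside $S$; induction bounds the number of coordinates by $f(M)$. In the case of equality,
  an element of weight $\lfloor M/2 \rfloor$ outside $S$ becomes one of weight $M$ after adding $0$ or
  $x$, whence by induction the elements of weight $M$ generate $G$ (modulo integers). For even $M$ all
  these estimates are tight on $S$: the coordinates of $y$, $y + x$, $y + 2x$, $y + 3x$ in $S$ are
  alternately integral and non-integral, and so $2x$ is integral for every generator $x$.
\<close>

subsection \<open>Groups of real tuples with few non-integral coordinates\<close>

lemma floor_sum_eq: "floor_sum M = (\<Sum>n\<le>M. M div 2 ^ n)"
proof -
  have "M div 2 ^ n = 0" if "n \<notin> {..M}" for n
    using that less_trans[of M n "2 ^ n"] by simp
  then show ?thesis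
    unfolding floor_sum_def by (intro suminf_finite) auto
qed

lemma floor_sum_0 [simp]: "floor_sum 0 = 0"
  by (simp add: floor_sum_eq)

text \<open>Shifting the summation index halves the argument. The induction on coordinate sets below
  has the same shape: \<open>M\<close> coordinates form a support of maximal weight, and the others
  satisfy the bound for \<open>M div 2\<close>.\<close>

lemma floor_sum_rec: "floor_sum M = M + floor_sum (M div 2)"
proof (cases M)
  case (Suc m)
  have "floor_sum M = M + (\<Sum>n\<le>m. M div 2 div 2 ^ n)"
    unfolding floor_sum_eq Suc by (subst sum.atMost_Suc_shift) (simp add: div_mult2_eq)
  also have "(\<Sum>n\<le>m. M div 2 div 2 ^ n) = (\<Sum>n\<le>M div 2. M div 2 div 2 ^ n)"
  proof (rule sum.mono_neutral_right)
    show "\<forall>n\<in>{..m} - {..M div 2}. M div 2 div 2 ^ n = 0"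
      by (metis DiffE atMost_iff div_less less_exp less_trans not_le)
  qed (use Suc in auto)
  finally show ?thesis by (simp add: floor_sum_eq)
qed simp

text \<open>Strictness comes from the leading term of the recursion; the remaining term is only
  weakly monotone.\<close>

lemma floor_sum_less: "m < M \<Longrightarrow> floor_sum m < floor_sum M"
proof (induction M arbitrary: m rule: less_induct)
  case (less M)
  have "floor_sum (m div 2) \<le> floor_sum (M div 2)"
  proof (cases "m div 2 = M div 2")
    case False
    with less.prems have "m div 2 < M div 2" by (meson div_le_mono le_less order_less_imp_le)
    with less.IH[of "M div 2" "m div 2"] less.prems show ?thesis by simp
  qed simp
  with less.prems show ?case
    by (subst (1 2) floor_sum_rec) simp
qed

lemma floor_sum_mono: "m \<le> M \<Longrightarrow> floor_sum m \<le> floor_sum M"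
  using floor_sum_less[of m M] by (cases "m = M") auto

section \<open>Subgroups of real tuples and their weights\<close>

text \<open>This is the one-step subgroup test. Working with real representatives instead of classes
  modulo the integers leaves plain real arithmetic on the coordinates.\<close>

definition real_fun_subgroup :: "('a \<Rightarrow> real) set \<Rightarrow> bool" where
  "real_fun_subgroup G \<longleftrightarrow> G \<noteq> {} \<and> (\<forall>x\<in>G. \<forall>y\<in>G. (\<lambda>i. x i - y i) \<in> G)"

lemma real_fun_subgroup_diff:
  "real_fun_subgroup G \<Longrightarrow> x \<in> G \<Longrightarrow> y \<in> G \<Longrightarrow> (\<lambda>i. x i - y i) \<in> G"
  by (auto simp: real_fun_subgroup_def)

lemma real_fun_subgroup_zero: "real_fun_subgroup G \<Longrightarrow> (\<lambda>i. 0) \<in> G"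
  using real_fun_subgroup_diff[of G] by (fastforce simp: real_fun_subgroup_def)

lemma real_fun_subgroup_add:
  assumes "real_fun_subgroup G" "x \<in> G" "y \<in> G"
  shows "(\<lambda>i. x i + y i) \<in> G"
  using real_fun_subgroup_diff[OF assms(1,2) real_fun_subgroup_diff[OF assms(1)
        real_fun_subgroup_zero[OF assms(1)] assms(3)]] by simp

text \<open>The support on \<open>I\<close> of the class of \<open>y\<close> modulo the integers;
  its cardinality is the weight of \<open>y\<close>.\<close>

definition nonint :: "'a set \<Rightarrow> ('a \<Rightarrow> real) \<Rightarrow> 'a set" where
  "nonint I y = {i \<in> I. y i \<notin> \<int>}"

lemma nonint_subset: "nonint I y \<subseteq> I"
  by (auto simp: nonint_def)

lemma finite_nonint [simp]: "finite I \<Longrightarrow> finite (nonint I y)"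
  by (simp add: nonint_def)

lemma card_nonint_split:
  assumes "finite I" "S \<subseteq> I"
  shows "card (nonint I y) = card (nonint S y) + card (nonint (I - S) y)"
proof -
  have "nonint I y = nonint S y \<union> nonint (I - S) y"
    using assms by (auto simp: nonint_def)
  then show ?thesis
    using assms by (simp add: card_Un_disjoint finite_subset nonint_def disjoint_iff)
qed

text \<open>If \<open>y i\<close> and \<open>y i + x i\<close> were both integers, so would be
  \<open>x i\<close>; hence the two supports cover \<open>S\<close>.\<close>

lemma card_nonint_add_ge:
  assumes "finite S" and "\<And>i. i \<in> S \<Longrightarrow> x i \<notin> \<int>"
  shows "card S \<le> card (nonint S y) + card (nonint S (\<lambda>i. y i + x i))"
proof -
  have "S \<subseteq> nonint S y \<union> nonint S (\<lambda>i. y i + x i)"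
    using assms(2) by (auto simp: nonint_def)
  then have "card S \<le> card (nonint S y \<union> nonint S (\<lambda>i. y i + x i))"
    using assms(1) by (intro card_mono) auto
  also have "\<dots> \<le> card (nonint S y) + card (nonint S (\<lambda>i. y i + x i))"
    by (rule card_Un_le)
  finally show ?thesis .
qed

text \<open>Adding \<open>x\<close> does not change integrality outside the support \<open>S\<close>
  of \<open>x\<close>. On \<open>S\<close> the weights of \<open>y\<close> and \<open>y + x\<close>
  add up to at least \<open>card S\<close>, while each total weight is at most
  \<open>card S\<close>; this leaves at most \<open>card S\<close> for twice the weight
  outside.\<close>

lemma card_nonint_off_max:
  assumes "finite I" "real_fun_subgroup G" and le: "\<And>y. y \<in> G \<Longrightarrow> card (nonint I y) \<le> card (nonint I x)"
    and "x \<in> G" "y \<in> G"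
  shows "card (nonint (I - nonint I x) y) \<le> card (nonint I x) div 2"
proof -
  define S where "S = nonint I x"
  have S: "S \<subseteq> I" "finite S" using assms(1) by (auto simp: S_def nonint_def)
  have "nonint (I - S) (\<lambda>i. y i + x i) = nonint (I - S) y"
    by (auto simp: nonint_def S_def)
  moreover have "card S \<le> card (nonint S y) + card (nonint S (\<lambda>i. y i + x i))"
    by (rule card_nonint_add_ge) (use S in \<open>auto simp: S_def nonint_def\<close>)
  moreover have "card (nonint I y) \<le> card S" "card (nonint I (\<lambda>i. y i + x i)) \<le> card S"
    using le assms real_fun_subgroup_add[OF assms(2)] by (auto simp: S_def)
  ultimately have "2 * card (nonint (I - S) y) \<le> card S"
    using card_nonint_split[OF assms(1) S(1), of y]
      card_nonint_split[OF assms(1) S(1), of "\<lambda>i. y i + x i"] by simp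
  then show ?thesis by (simp add: S_def)
qed

text \<open>Remove the support of an element of maximal weight \<open>m\<close> and apply the
  induction hypothesis with \<open>m div 2\<close> to the remaining coordinates. The group stays the
  same while the set \<open>I\<close> shrinks.\<close>

lemma card_le_floor_sum:
  assumes "finite I" "real_fun_subgroup G" "\<And>y. y \<in> G \<Longrightarrow> card (nonint I y) \<le> M"
    and "\<And>i. i \<in> I \<Longrightarrow> \<exists>y\<in>G. y i \<notin> \<int>"
  shows "card I \<le> floor_sum M"
  using assms
proof (induction M arbitrary: I rule: less_induct)
  case (less M)
  have "G \<noteq> {}" using less.prems(2) by (simp add: real_fun_subgroup_def)
  \<comment> \<open>\<open>G\<close> may be infinite, but its weights are bounded by
    \<open>M\<close>, so the maximum exists.\<close>
  define m where "m = Max ((\<lambda>y. card (nonint I y)) ` G)"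
  have fin: "finite ((\<lambda>y. card (nonint I y)) ` G)"
    using less.prems(3) by (auto intro: finite_subset[OF _ finite_atMost[of M]])
  have "m \<in> (\<lambda>y. card (nonint I y)) ` G"
    unfolding m_def using fin \<open>G \<noteq> {}\<close> by (intro Max_in) auto
  then obtain x where x: "x \<in> G" "card (nonint I x) = m" by auto
  have le: "card (nonint I y) \<le> card (nonint I x)" if "y \<in> G" for y
    using that fin by (auto simp: x m_def)
  define S where "S = nonint I x"
  have S: "S \<subseteq> I" "finite S" "card S = m"
    using less.prems(1) x by (auto simp: S_def nonint_def)
  have card_I: "card I = m + card (I - S)"
    using S less.prems(1) by (metis card_Diff_subset card_mono le_add_diff_inverse)
  have "m \<le> M" using less.prems(3)[OF x(1)] x by simp
  show ?case
  proof (cases "m = 0")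
    case True
    have "I = {}"
    proof (rule ccontr)
      assume "I \<noteq> {}"
      then obtain i y where iy: "i \<in> I" "y \<in> G" "y i \<notin> \<int>" using less.prems(4) by blast
      then have "i \<in> nonint I y" by (simp add: nonint_def)
      with le[OF iy(2)] x(2) True less.prems(1) show False by auto
    qed
    then show ?thesis by simp
  next
    case False
    with \<open>m \<le> M\<close> have "m div 2 < M" by linarith
    then have "card (I - S) \<le> floor_sum (m div 2)"
    proof (rule less.IH)
      show "card (nonint (I - S) y) \<le> m div 2" if "y \<in> G" for y
        unfolding S_def x(2)[symmetric]
        by (rule card_nonint_off_max) (use less.prems le x that in auto)
    qed (use less.prems in auto)
    then have "card I \<le> floor_sum m"
      by (subst floor_sum_rec) (simp add: card_I)
    then show ?thesis using floor_sum_mono[OF \<open>m \<le> M\<close>] by simp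
  qed
qed

section \<open>Groups attaining the bound on the number of coordinates\<close>

text \<open>Otherwise the bound holds with \<open>M - 1\<close>, contradicting that
  \<open>floor_sum\<close> is strictly increasing.\<close>

lemma weight_attained:
  assumes "finite I" "real_fun_subgroup G" "\<And>y. y \<in> G \<Longrightarrow> card (nonint I y) \<le> M"
    and "\<And>i. i \<in> I \<Longrightarrow> \<exists>y\<in>G. y i \<notin> \<int>" and "card I = floor_sum M"
  shows "\<exists>x\<in>G. card (nonint I x) = M"
proof (rule ccontr)
  assume neg: "\<not> ?thesis"
  then have less: "card (nonint I y) < M" if "y \<in> G" for y
    using assms(3)[OF that] that by fastforce
  have "M > 0" using assms(2) less by (force simp: real_fun_subgroup_def)
  have "card I \<le> floor_sum (M - 1)"
  proof (rule card_le_floor_sum[where G = G])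
    show "card (nonint I y) \<le> M - 1" if "y \<in> G" for y
      using less[OF that] by simp
  qed (use assms in auto)
  with floor_sum_less[of "M - 1" M] \<open>M > 0\<close> assms(5) show False by simp
qed

text \<open>Extremality is inherited: on the complement of a support of weight \<open>M\<close>, the
  same group is extremal for \<open>M div 2\<close>.\<close>

lemma off_max_extremal:
  assumes "finite I" "real_fun_subgroup G" "\<And>y. y \<in> G \<Longrightarrow> card (nonint I y) \<le> M"
    and "\<And>i. i \<in> I \<Longrightarrow> \<exists>y\<in>G. y i \<notin> \<int>" and "card I = floor_sum M"
    and x: "x \<in> G" "card (nonint I x) = M"
  shows "\<And>y. y \<in> G \<Longrightarrow> card (nonint (I - nonint I x) y) \<le> M div 2"
    and "card (I - nonint I x) = floor_sum (M div 2)"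
    and "\<exists>z\<in>G. card (nonint (I - nonint I x) z) = M div 2"
proof -
  show le: "card (nonint (I - nonint I x) y) \<le> M div 2" if "y \<in> G" for y
    using card_nonint_off_max[OF assms(1,2) _ x(1) that] assms(3) x(2) by simp
  show c: "card (I - nonint I x) = floor_sum (M div 2)"
    using assms(1,5) x(2) floor_sum_rec[of M] by (simp add: card_Diff_subset nonint_subset)
  show "\<exists>z\<in>G. card (nonint (I - nonint I x) z) = M div 2"
    by (rule weight_attained) (use assms le c in auto)
qed

text \<open>Generation is expressed through an arbitrary subgroup \<open>H\<close> containing all
  elements of weight \<open>M\<close>. Elements of weight \<open>M div 2\<close> outside
  \<open>S\<close> lie in \<open>H\<close>; the induction hypothesis on \<open>I - S\<close> reduces
  the rest to elements integral outside \<open>S\<close>, which are differences of two such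
  elements.\<close>

lemma max_weight_generate:
  assumes "finite I" "real_fun_subgroup G" "\<And>y. y \<in> G \<Longrightarrow> card (nonint I y) \<le> M"
    and "\<And>i. i \<in> I \<Longrightarrow> \<exists>y\<in>G. y i \<notin> \<int>" and "card I = floor_sum M"
    and "real_fun_subgroup H" "H \<subseteq> G" "\<And>y. y \<in> G \<Longrightarrow> card (nonint I y) = M \<Longrightarrow> y \<in> H"
  shows "G \<subseteq> H"
  using assms
proof (induction M arbitrary: I H rule: less_induct)
  case (less M)
  note prems = less.prems
  show ?case
  proof (cases "M = 0")
    case True
    then have "I = {}" using prems(1,5) by simp
    then have "nonint I y = {}" for y by (auto simp: nonint_def)
    then show ?thesis using prems(8) True by auto
  next
    case False
    obtain x where x: "x \<in> G" "card (nonint I x) = M"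
      using weight_attained[OF prems(1-5)] by auto
    define S where "S = nonint I x"
    have S: "S \<subseteq> I" "finite S" "card S = M"
      using prems(1) x by (auto simp: S_def nonint_def)
    note ext = off_max_extremal[OF prems(1-5) x, folded S_def]
    have "x \<in> H" using prems(8) x by auto
    \<comment> \<open>The weights of \<open>z\<close> and \<open>z + x\<close> add up to at least
      \<open>M + 2 * (M div 2)\<close>, hence to at least \<open>2 * M - 1\<close>. As both are at
      most \<open>M\<close>, one of them equals \<open>M\<close>, also for odd
      \<open>M\<close>.\<close>
    have in_H: "z \<in> H" if z: "z \<in> G" "card (nonint (I - S) z) = M div 2" for z
    proof -
      have "nonint (I - S) (\<lambda>i. z i + x i) = nonint (I - S) z"
        by (auto simp: nonint_def S_def)
      then have eq: "card (nonint (I - S) (\<lambda>i. z i + x i)) = M div 2"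
        using z by simp
      have "card S \<le> card (nonint S z) + card (nonint S (\<lambda>i. z i + x i))"
        by (rule card_nonint_add_ge) (use S in \<open>auto simp: S_def nonint_def\<close>)
      moreover have "card (nonint I z) \<le> M" "card (nonint I (\<lambda>i. z i + x i)) \<le> M"
        using prems(3) z x real_fun_subgroup_add[OF prems(2)] by auto
      ultimately have "card (nonint I z) = M \<or> card (nonint I (\<lambda>i. z i + x i)) = M"
        using card_nonint_split[OF prems(1) S(1), of z] z(2) eq S(3)
          card_nonint_split[OF prems(1) S(1), of "\<lambda>i. z i + x i"] by presburger
      then have "z \<in> H \<or> (\<lambda>i. z i + x i) \<in> H"
        using prems(8) z x real_fun_subgroup_add[OF prems(2)] by auto
      then show ?thesis
        using real_fun_subgroup_diff[OF prems(6) _ \<open>x \<in> H\<close>, of "\<lambda>i. z i + x i"] by auto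
    qed
    \<comment> \<open>\<open>H'\<close> compares with \<open>H\<close> only modulo integers on
      \<open>I - S\<close>; the difference, integral there, is handled by \<open>w\<close>
      below.\<close>
    define H' where "H' = {y \<in> G. \<exists>h\<in>H. \<forall>i\<in>I - S. y i - h i \<in> \<int>}"
    have "H \<subseteq> H'"
    proof
      show "h \<in> H'" if "h \<in> H" for h
        using that prems(7) unfolding H'_def by (auto intro!: bexI[of _ h])
    qed
    have H': "real_fun_subgroup H'"
      unfolding real_fun_subgroup_def
    proof (intro conjI ballI)
      show "H' \<noteq> {}" using \<open>H \<subseteq> H'\<close> \<open>x \<in> H\<close> by auto
      fix y z assume "y \<in> H'" "z \<in> H'"
      then obtain h k where hk: "h \<in> H" "k \<in> H" "\<forall>i\<in>I - S. y i - h i \<in> \<int>"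
        "\<forall>i\<in>I - S. z i - k i \<in> \<int>" and yz: "y \<in> G" "z \<in> G" by (auto simp: H'_def)
      have "\<forall>i\<in>I - S. y i - z i - (h i - k i) \<in> \<int>"
      proof
        fix i assume "i \<in> I - S"
        with hk have "y i - h i \<in> \<int>" "z i - k i \<in> \<int>" by auto
        then have "(y i - h i) - (z i - k i) \<in> \<int>" by (rule Ints_diff)
        then show "y i - z i - (h i - k i) \<in> \<int>" by (simp add: algebra_simps)
      qed
      then show "(\<lambda>i. y i - z i) \<in> H'"
        using real_fun_subgroup_diff[OF prems(2) yz]
          real_fun_subgroup_diff[OF prems(6) hk(1,2)]
        by (auto simp: H'_def intro!: bexI[of _ "\<lambda>i. h i - k i"])
    qed
    have "G \<subseteq> H'"
    proof (rule less.IH[of "M div 2" "I - S"])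
      show "y \<in> H'" if "y \<in> G" "card (nonint (I - S) y) = M div 2" for y
        using in_H[OF that] \<open>H \<subseteq> H'\<close> by auto
    qed (use False prems ext(1,2) prems(1) H' in \<open>auto simp: H'_def\<close>)
    obtain z where z: "z \<in> G" "card (nonint (I - S) z) = M div 2"
      using ext(3) by auto
    show ?thesis
    proof
      fix u assume "u \<in> G"
      with \<open>G \<subseteq> H'\<close> obtain h where h: "h \<in> H" "\<forall>i\<in>I - S. u i - h i \<in> \<int>"
        by (auto simp: H'_def)
      define w where "w = (\<lambda>i. u i - h i)"
      have w: "w \<in> G"
        unfolding w_def using \<open>u \<in> G\<close> h prems(2,7) by (intro real_fun_subgroup_diff) auto
      \<comment> \<open>As \<open>w\<close> is integral outside \<open>S\<close>, both
        \<open>z\<close> and \<open>w + z\<close> have weight \<open>M div 2\<close> there and so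
        lie in \<open>H\<close>; hence \<open>w\<close> does too.\<close>
      have "nonint (I - S) (\<lambda>i. w i + z i) = nonint (I - S) z"
        using h(2) by (auto simp: nonint_def w_def)
      then have "(\<lambda>i. w i + z i) \<in> H"
        using in_H z w real_fun_subgroup_add[OF prems(2)] by simp
      then have "(\<lambda>i. (w i + z i) - z i) \<in> H"
        using in_H[OF z] by (rule real_fun_subgroup_diff[OF prems(6)])
      then have "(\<lambda>i. w i + h i) \<in> H"
        using h(1) by (simp add: real_fun_subgroup_add[OF prems(6)])
      then show "u \<in> H" by (simp add: w_def)
    qed
  qed
qed

text \<open>Start from \<open>y\<close> of weight \<open>M div 2\<close> outside \<open>S\<close>.
  The supports of \<open>y\<close> and \<open>y + x\<close> on \<open>S\<close> cover
  \<open>S\<close> and are too small to overlap, so adding \<open>x\<close> flips integrality at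
  every coordinate in \<open>S\<close>. Two integral values two steps apart differ by
  \<open>2 * x i\<close>.\<close>

lemma max_weight_half_integral:
  assumes "finite I" "real_fun_subgroup G" "\<And>y. y \<in> G \<Longrightarrow> card (nonint I y) \<le> M"
    and "\<And>i. i \<in> I \<Longrightarrow> \<exists>y\<in>G. y i \<notin> \<int>" and "card I = floor_sum M"
    and "even M" and x: "x \<in> G" "card (nonint I x) = M" and "i \<in> I"
  shows "2 * x i \<in> \<int>"
proof (cases "x i \<in> \<int>")
  case False
  define S where "S = nonint I x"
  have S: "S \<subseteq> I" "finite S" "card S = M"
    using assms(1) x by (auto simp: S_def nonint_def)
  have "i \<in> S" using False assms by (simp add: S_def nonint_def)
  note ext = off_max_extremal[OF assms(1-5) x, folded S_def]
  obtain y where y: "y \<in> G" "card (nonint (I - S) y) = M div 2" using ext(3) by auto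
  \<comment> \<open>Evenness enters here: for even \<open>M\<close>, the weight left for
    \<open>S\<close> is \<open>M - M div 2 = M div 2\<close>.\<close>
  have le: "card (nonint S z) \<le> M div 2" if "z \<in> G" "card (nonint (I - S) z) = M div 2" for z
    using card_nonint_split[OF assms(1) S(1), of z] assms(3)[OF that(1)] that(2) \<open>even M\<close>
    by (auto elim!: evenE)
  have step: "(\<lambda>i. z i + x i) \<in> G \<and> card (nonint (I - S) (\<lambda>i. z i + x i)) = M div 2 \<and>
      (z i \<in> \<int> \<longleftrightarrow> z i + x i \<notin> \<int>)"
    if z: "z \<in> G" "card (nonint (I - S) z) = M div 2" for z
  proof -
    have "nonint (I - S) (\<lambda>i. z i + x i) = nonint (I - S) z"
      by (auto simp: nonint_def S_def)
    then have zx: "(\<lambda>i. z i + x i) \<in> G" "card (nonint (I - S) (\<lambda>i. z i + x i)) = M div 2"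
      using z x real_fun_subgroup_add[OF assms(2)] by auto
    define A where "A = nonint S z"
    define B where "B = nonint S (\<lambda>i. z i + x i)"
    have AB: "finite A" "finite B" using S by (auto simp: A_def B_def)
    have "S = A \<union> B" by (auto simp: A_def B_def nonint_def S_def)
    moreover have "card A + card B \<le> M"
      using le[OF z] le[OF zx] \<open>even M\<close> by (auto simp: A_def B_def)
    ultimately have "card (A \<inter> B) = 0"
      using card_Un_Int[OF AB] S by simp
    then have "i \<notin> A \<inter> B" using AB by auto
    moreover have "i \<in> A \<union> B" using \<open>S = A \<union> B\<close> \<open>i \<in> S\<close> by simp
    ultimately show ?thesis using zx \<open>i \<in> S\<close> by (auto simp: A_def B_def nonint_def)
  qed
  note s1 = step[OF y]
  note s2 = step[OF s1[THEN conjunct1] s1[THEN conjunct2, THEN conjunct1]]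
  \<comment> \<open>The third step serves the case where \<open>y i\<close> is not an integer: then
    \<open>y + x\<close> and \<open>y + 3x\<close> are integral at \<open>i\<close>.\<close>
  note s3 = step[OF s2[THEN conjunct1] s2[THEN conjunct2, THEN conjunct1]]
  show ?thesis
  proof (cases "y i \<in> \<int>")
    case True
    with s1 s2 have "y i + x i + x i - y i \<in> \<int>" by (intro Ints_diff) auto
    then show ?thesis by simp
  next
    case False
    with s1 s2 s3 have "y i + x i + x i + x i - (y i + x i) \<in> \<int>" by (intro Ints_diff) auto
    then show ?thesis by simp
  qed
qed (simp add: Ints_mult)

text \<open>Half-integrality on \<open>I\<close> is preserved under differences, so it suffices to
  have it for the generators of weight \<open>M\<close>.\<close>

proposition extremal_half_integral:
  assumes "finite I" "real_fun_subgroup G" "\<And>y. y \<in> G \<Longrightarrow> card (nonint I y) \<le> M"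
    and "\<And>i. i \<in> I \<Longrightarrow> \<exists>y\<in>G. y i \<notin> \<int>" and "card I = floor_sum M"
    and "even M" "u \<in> G" "i \<in> I"
  shows "2 * u i \<in> \<int>"
proof -
  define H where "H = {y \<in> G. \<forall>i\<in>I. 2 * y i \<in> \<int>}"
  have "real_fun_subgroup H"
    unfolding real_fun_subgroup_def
  proof (intro conjI ballI)
    show "H \<noteq> {}" using real_fun_subgroup_zero[OF assms(2)] by (auto simp: H_def)
    show "(\<lambda>i. x i - y i) \<in> H" if "x \<in> H" "y \<in> H" for x y
      using that real_fun_subgroup_diff[OF assms(2)] by (auto simp: H_def right_diff_distrib)
  qed
  moreover have "H \<subseteq> G" by (auto simp: H_def)
  moreover have "y \<in> H" if "y \<in> G" "card (nonint I y) = M" for y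
    using max_weight_half_integral[OF assms(1-6) that] that by (auto simp: H_def)
  ultimately have "G \<subseteq> H"
    using max_weight_generate[OF assms(1-5), of H] by blast
  with assms(7,8) show ?thesis by (auto simp: H_def)
qed

subsection \<open>Completion to unimodular matrices\<close>

text \<open>Multiplying by it on the right adds \<open>a\<close> times column \<open>p\<close> to
  column \<open>q\<close>.\<close>

definition elementary_matrix :: "'n \<Rightarrow> 'n \<Rightarrow> int \<Rightarrow> int ^ 'n ^ 'n" where
  "elementary_matrix p q a = (\<chi> i j. of_bool (i = j) + of_bool (i = p \<and> j = q) * a)"

lemma row_mult_elementary_matrix:
  "(A ** elementary_matrix p q a) $ k = (\<chi> j. A $ k $ j + of_bool (j = q) * (A $ k $ p * a))"
  by (simp add: vec_eq_iff matrix_matrix_mult_def elementary_matrix_def of_bool_conj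
      sum.distrib distrib_left mult.assoc[symmetric] of_bool_def if_distrib[of "(*) x" for x]
      if_distrib[of "\<lambda>x. x * y" for y] cong: if_cong)

lemma invertible_elementary_matrix:
  assumes "p \<noteq> q"
  shows "invertible (elementary_matrix p q a)"
proof -
  have "elementary_matrix p q b ** elementary_matrix p q (- b) = mat 1" for b
    using assms by (simp add: vec_eq_iff row_mult_elementary_matrix)
      (auto simp: elementary_matrix_def mat_def)
  from this[of a] this[of "- a"] show ?thesis
    by (auto simp: invertible_def)
qed

text \<open>Column operations of the Euclidean algorithm reduce the row to a signed unit vector.\<close>

lemma unimodular_completion:
  fixes c :: "int ^ 'n"
  assumes "\<And>d. (\<And>i. d dvd c $ i) \<Longrightarrow> \<bar>d\<bar> = 1"
  shows "\<exists>k (A :: int ^ 'n ^ 'n). invertible A \<and> A $ k = c"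
  using assms
proof (induction "\<Sum>i\<in>UNIV. nat \<bar>c $ i\<bar>" arbitrary: c rule: less_induct)
  case less
  show ?case
  proof (cases "\<exists>p q. p \<noteq> q \<and> c $ p \<noteq> 0 \<and> c $ q \<noteq> 0")
    case True
    then obtain p q where pq: "p \<noteq> q" "c $ p \<noteq> 0" "c $ q \<noteq> 0" "\<bar>c $ p\<bar> \<le> \<bar>c $ q\<bar>"
      by (metis linear)
    \<comment> \<open>The sign makes \<open>c $ p * e\<close> have absolute value
      \<bar>\<open>c $ p\<close>\<bar> and the sign of \<open>c $ q\<close>, so that subtracting it
      moves \<open>c $ q\<close> towards zero.\<close>
    define e where "e = sgn (c $ p) * sgn (c $ q)"
    define c' where "c' = (\<chi> j. c $ j - of_bool (j = q) * (c $ p * e))"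
    have "\<bar>c $ q - c $ p * e\<bar> < \<bar>c $ q\<bar>"
      using pq by (auto simp: e_def sgn_if abs_if split: if_splits)
    then have "(\<Sum>i\<in>UNIV. nat \<bar>c' $ i\<bar>) < (\<Sum>i\<in>UNIV. nat \<bar>c $ i\<bar>)"
      by (intro sum_strict_mono_ex1) (auto simp: c'_def intro!: exI[of _ q])
    moreover have "\<bar>d\<bar> = 1" if d: "\<And>i. d dvd c' $ i" for d
    proof (rule less.prems)
      have p: "d dvd c $ p" using d[of p] pq by (simp add: c'_def)
      have "d dvd c' $ q + c $ p * e" using p d by (intro dvd_add) auto
      then show "d dvd c $ i" for i using d[of i] by (cases "i = q") (auto simp: c'_def)
    qed
    ultimately obtain k and A :: "int ^ 'n ^ 'n" where A: "invertible A" "A $ k = c'"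
      using less.hyps by blast
    have "(A ** elementary_matrix p q e) $ k = c"
      using pq by (simp add: row_mult_elementary_matrix A vec_eq_iff) (simp add: c'_def)
    moreover have "invertible (A ** elementary_matrix p q e)"
      using A pq by (intro invertible_mult invertible_elementary_matrix) auto
    ultimately show ?thesis by blast
  next
    case False
    \<comment> \<open>If the row vanished, \<open>0\<close> would be a common divisor of its
      entries.\<close>
    have "\<exists>k. c $ k \<noteq> 0"
      using less.prems[of 0] by fastforce
    then obtain k where k: "c $ k \<noteq> 0" by auto
    with False have c0: "c $ j = 0" if "j \<noteq> k" for j using that by blast
    have "\<bar>c $ k\<bar> = 1"
      by (rule less.prems) (metis c0 dvd_0_right dvd_refl)
    then have sq: "c $ k * c $ k = 1" by (metis abs_mult_self_eq mult_1)
    define A where "A = (\<chi> i j. of_bool (i = j) * (if i = k then c $ k else 1))"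
    have "A ** A = mat 1"
      using sq by (auto simp: vec_eq_iff A_def matrix_matrix_mult_def mat_def of_bool_def
          if_distrib[of "\<lambda>x. x * y" for y] cong: if_cong)
    then have "invertible A" by (auto simp: invertible_def)
    moreover have "A $ k = c" by (auto simp: A_def vec_eq_iff c0)
    ultimately show ?thesis by blast
  qed
qed

subsection \<open>Lattice simplices\<close>

lemma int_lattice_0 [simp]: "0 \<in> int_lattice"
  by (simp add: int_lattice_def)

lemma int_lattice_add: "x \<in> int_lattice \<Longrightarrow> y \<in> int_lattice \<Longrightarrow> x + y \<in> int_lattice"
  by (simp add: int_lattice_def)

lemma int_lattice_diff: "x \<in> int_lattice \<Longrightarrow> y \<in> int_lattice \<Longrightarrow> x - y \<in> int_lattice"
  by (simp add: int_lattice_def)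

lemma int_lattice_scaleR: "a \<in> \<int> \<Longrightarrow> x \<in> int_lattice \<Longrightarrow> a *\<^sub>R x \<in> int_lattice"
  by (simp add: int_lattice_def)

lemma int_lattice_sum: "(\<And>i. i \<in> A \<Longrightarrow> f i \<in> int_lattice) \<Longrightarrow> sum f A \<in> int_lattice"
  by (induction A rule: infinite_finite_induct) (auto intro: int_lattice_add)

lemma finite_int_lattice_Int:
  fixes S :: "(real ^ 'n) set"
  assumes "bounded S"
  shows "finite (S \<inter> int_lattice)"
proof -
  obtain b where b: "norm x \<le> b" if "x \<in> S" for x
    using assms by (auto simp: bounded_iff)
  define K where "K = {-\<lceil>b\<rceil>..\<lceil>b\<rceil>}"
  have "S \<inter> int_lattice \<subseteq> (\<lambda>f. \<chi> i. real_of_int (f i)) ` (UNIV \<rightarrow>\<^sub>E K :: ('n \<Rightarrow> int) set)"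
  proof
    fix x assume x: "x \<in> S \<inter> int_lattice"
    have "\<lfloor>x $ i\<rfloor> \<in> K" for i
    proof -
      have "x $ i \<in> \<int>" using x by (simp add: int_lattice_def)
      moreover have "\<bar>x $ i\<bar> \<le> b"
        using x b component_le_norm_cart[of x i] by (force intro: order_trans)
      ultimately show ?thesis by (auto simp: K_def elim!: Ints_cases) linarith+
    qed
    moreover have "x = (\<chi> i. real_of_int \<lfloor>x $ i\<rfloor>)"
      using x by (simp add: int_lattice_def vec_eq_iff)
    ultimately show "x \<in> (\<lambda>f. \<chi> i. real_of_int (f i)) ` (UNIV \<rightarrow>\<^sub>E K)"
      by (intro image_eqI[where x = "\<lambda>i. \<lfloor>x $ i\<rfloor>"]) auto
  qed
  moreover have "finite (UNIV \<rightarrow>\<^sub>E K :: ('n \<Rightarrow> int) set)"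
    by (intro finite_PiE) (auto simp: K_def)
  ultimately show ?thesis by (meson finite_imageI finite_subset)
qed

section \<open>Barycentric coordinates of a full-dimensional lattice simplex\<close>

locale lattice_simplex =
  fixes v :: "'i \<Rightarrow> real ^ 'n" and I :: "'i set"
  assumes finite_I [simp]: "finite I"
    and card_I: "card I = CARD('n) + 1"
    and inj_v: "inj_on v I"
    and indep_v: "\<not> affine_dependent (v ` I)"
    and integral_v: "\<And>i. i \<in> I \<Longrightarrow> v i \<in> int_lattice"
begin

text \<open>The coordinates need not sum to 1: \<open>comb\<close> and \<open>coord_sum\<close>
  together describe a point of the homogenised space, with \<open>coord_sum\<close> as its
  height.\<close>

definition comb :: "('i \<Rightarrow> real) \<Rightarrow> real ^ 'n" where
  "comb y = (\<Sum>i\<in>I. y i *\<^sub>R v i)"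

definition coord_sum :: "('i \<Rightarrow> real) \<Rightarrow> real" where
  "coord_sum y = (\<Sum>i\<in>I. y i)"

text \<open>The preimage of \<Lambda> under reduction modulo the integers; values outside
  \<open>I\<close> are arbitrary.\<close>

definition G :: "('i \<Rightarrow> real) set" where
  "G = {y. comb y \<in> int_lattice \<and> coord_sum y \<in> \<int>}"

lemma comb_diff: "comb (\<lambda>i. y i - z i) = comb y - comb z"
  by (simp add: comb_def scaleR_left_diff_distrib sum_subtractf)

lemma coord_sum_diff: "coord_sum (\<lambda>i. y i - z i) = coord_sum y - coord_sum z"
  by (simp add: coord_sum_def sum_subtractf)

lemma comb_scale: "comb (\<lambda>i. a * y i) = a *\<^sub>R comb y"
  by (simp add: comb_def scaleR_sum_right)

lemma coord_sum_scale: "coord_sum (\<lambda>i. a * y i) = a * coord_sum y"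
  by (simp add: coord_sum_def sum_distrib_left)

text \<open>A nonzero difference of the two tuples would be an affine dependence of the
  vertices.\<close>

lemma comb_eqD:
  assumes "comb y = comb z" "coord_sum y = coord_sum z" "i \<in> I"
  shows "y i = z i"
proof (rule ccontr)
  assume "y i \<noteq> z i"
  define U where "U x = (let j = the_inv_into I v x in y j - z j)" for x
  have U: "U (v j) = y j - z j" if "j \<in> I" for j
    using that by (simp only: U_def Let_def the_inv_into_f_f[OF inj_v that])
  have "sum U (v ` I) = coord_sum (\<lambda>i. y i - z i)"
    unfolding coord_sum_def by (subst sum.reindex[OF inj_v]) (intro sum.cong refl, simp only: U o_def)
  then have 1: "sum U (v ` I) = 0" using assms by (simp add: coord_sum_diff)
  have "(\<Sum>x\<in>v ` I. U x *\<^sub>R x) = comb (\<lambda>i. y i - z i)"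
    unfolding comb_def by (subst sum.reindex[OF inj_v]) (intro sum.cong refl, simp only: U o_def)
  then have 2: "(\<Sum>x\<in>v ` I. U x *\<^sub>R x) = 0" using assms by (simp add: comb_diff)
  have "U (v i) \<noteq> 0" using U assms(3) \<open>y i \<noteq> z i\<close> by simp
  then have "affine_dependent (v ` I)"
    using 1 2 assms(3) by (subst affine_dependent_explicit_finite) auto
  then show False using indep_v by simp
qed

lemma ex_comb: "\<exists>y. comb y = x \<and> coord_sum y = 1"
proof -
  have "card (v ` I) = Suc DIM(real ^ 'n)"
    by (simp add: card_image[OF inj_v] card_I)
  then have "x \<in> affine hull (v ` I)"
    using affine_independent_span_eq[OF indep_v] by simp
  then obtain u where "sum u (v ` I) = 1" "(\<Sum>w\<in>v ` I. u w *\<^sub>R w) = x"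
    by (auto simp: affine_hull_finite)
  then have "comb (u \<circ> v) = x \<and> coord_sum (u \<circ> v) = 1"
    by (simp add: comb_def coord_sum_def sum.reindex[OF inj_v] o_def)
  then show ?thesis by blast
qed

lemma scaled_hull:
  "(\<lambda>x. real n *\<^sub>R x) ` (convex hull (v ` I)) =
     comb ` {y. (\<forall>i\<in>I. 0 \<le> y i) \<and> coord_sum y = real n}"
proof -
  have hull: "convex hull (v ` I) = comb ` {y. (\<forall>i\<in>I. 0 \<le> y i) \<and> coord_sum y = 1}" (is "?L = ?R")
  proof
    show "?L \<subseteq> ?R"
    proof
      fix x assume "x \<in> ?L"
      then obtain u where "\<forall>w\<in>v ` I. 0 \<le> u w" "sum u (v ` I) = 1" "(\<Sum>w\<in>v ` I. u w *\<^sub>R w) = x"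
        by (auto simp: convex_hull_finite)
      then show "x \<in> ?R"
        by (intro image_eqI[of _ _ "u \<circ> v"])
          (auto simp: comb_def coord_sum_def sum.reindex[OF inj_v])
    qed
    show "?R \<subseteq> ?L"
    proof
      fix x assume "x \<in> ?R"
      then obtain y where y: "\<forall>i\<in>I. 0 \<le> y i" "sum y I = 1" "x = (\<Sum>i\<in>I. y i *\<^sub>R v i)"
        by (auto simp: comb_def coord_sum_def)
      then show "x \<in> ?L"
        by (auto intro!: convex_sum[OF finite_I convex_convex_hull] intro: hull_inc)
    qed
  qed
  show ?thesis
  \<comment> \<open>Rescaling by \<open>1 / n\<close> fails for \<open>n = 0\<close>; there
    nonnegative coordinates with sum 0 vanish, and both sides are the origin.\<close>
  proof (cases "n = 0")
    case True
    have "comb y = 0" if "\<forall>i\<in>I. 0 \<le> y i" "coord_sum y = 0" for y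
    proof -
      have "\<forall>i\<in>I. y i = 0"
        using that unfolding coord_sum_def by (subst (asm) sum_nonneg_eq_0_iff) auto
      then show ?thesis by (simp add: comb_def)
    qed
    moreover have "coord_sum (\<lambda>i. 0) = 0" by (simp add: coord_sum_def)
    moreover have "convex hull (v ` I) \<noteq> {}" using card_I by auto
    ultimately show ?thesis
      using True by (force simp: image_constant_conv image_iff)
  next
    case False
    have "(\<lambda>x. real n *\<^sub>R x) ` (convex hull (v ` I)) =
      (\<lambda>y. comb (\<lambda>i. real n * y i)) ` {y. (\<forall>i\<in>I. 0 \<le> y i) \<and> coord_sum y = 1}"
      by (simp add: hull image_image comb_scale)
    also have "\<dots> = comb ` (\<lambda>y i. real n * y i) ` {y. (\<forall>i\<in>I. 0 \<le> y i) \<and> coord_sum y = 1}"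
      by (simp add: image_image)
    also have "(\<lambda>y i. real n * y i) ` {y. (\<forall>i\<in>I. 0 \<le> y i) \<and> coord_sum y = 1} =
      {y. (\<forall>i\<in>I. 0 \<le> y i) \<and> coord_sum y = real n}" (is "?f ` ?A = ?B")
    proof
      show "?f ` ?A \<subseteq> ?B" by (auto simp: coord_sum_scale)
      show "?B \<subseteq> ?f ` ?A"
      proof
        fix y assume "y \<in> ?B"
        then show "y \<in> ?f ` ?A"
          using False coord_sum_scale[of "1 / real n" y]
          by (intro image_eqI[of _ _ "\<lambda>i. (1 / real n) * y i"]) auto
      qed
    qed
    finally show ?thesis .
  qed
qed

section \<open>The group of the simplex and its nonnegative elements by height\<close>

lemma subgroup_G: "real_fun_subgroup G"
proof -
  have "comb (\<lambda>i. 0) = 0" "coord_sum (\<lambda>i. 0) = 0" by (simp_all add: comb_def coord_sum_def)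
  then have "(\<lambda>i. 0) \<in> G" by (simp add: G_def)
  then show ?thesis
    unfolding real_fun_subgroup_def
    by (auto simp: G_def comb_diff coord_sum_diff intro: int_lattice_diff)
qed

text \<open>Since the vertices are lattice points, every tuple with integer entries on
  \<open>I\<close> lies in \<open>G\<close>.\<close>

lemma G_cong_mod_1:
  assumes "y \<in> G" "\<And>i. i \<in> I \<Longrightarrow> y i - z i \<in> \<int>"
  shows "z \<in> G"
proof -
  have "comb (\<lambda>i. y i - z i) \<in> int_lattice"
    unfolding comb_def using assms integral_v by (intro int_lattice_sum int_lattice_scaleR) auto
  moreover have "coord_sum (\<lambda>i. y i - z i) \<in> \<int>"
    unfolding coord_sum_def using assms by (intro Ints_sum) auto
  ultimately have "(\<lambda>i. y i - z i) \<in> G" by (simp add: G_def)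
  from real_fun_subgroup_diff[OF subgroup_G assms(1) this] show ?thesis by simp
qed

text \<open>Removing the bound $y_i < 1$ for one index $i$ divides the generating function of the slices by
  $1 - t$, since the new points are those of the slice below shifted by a unit vector. Removing all
  bounds leads from the box points to the Ehrhart series.\<close>

definition slice :: "'i set \<Rightarrow> nat \<Rightarrow> ('i \<Rightarrow> real) set" where
  "slice J n = {y \<in> G. (\<forall>i. i \<notin> I \<longrightarrow> y i = 0) \<and> (\<forall>i\<in>I. 0 \<le> y i) \<and>
     (\<forall>i\<in>I - J. y i < 1) \<and> coord_sum y = real n}"

text \<open>For \<open>J = I\<close> no upper bounds remain. Injectivity uses that tuples in a slice
  vanish outside \<open>I\<close>.\<close>

lemma bij_betw_slice:
  "bij_betw comb (slice I n) ((\<lambda>x. real n *\<^sub>R x) ` (convex hull (v ` I)) \<inter> int_lattice)"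
  unfolding bij_betw_def scaled_hull
proof
  show "inj_on comb (slice I n)"
  proof (rule inj_onI, rule ext)
    fix y z i assume "y \<in> slice I n" "z \<in> slice I n" "comb y = comb z"
    then show "y i = z i"
      using comb_eqD[of y z i] by (cases "i \<in> I") (auto simp: slice_def)
  qed
  have "comb y \<in> comb ` slice I n"
    if y: "\<forall>i\<in>I. 0 \<le> y i" "coord_sum y = real n" "comb y \<in> int_lattice" for y
  proof -
    define z where "z i = (if i \<in> I then y i else 0)" for i
    have "comb z = comb y" "coord_sum z = coord_sum y"
      unfolding comb_def coord_sum_def by (auto intro!: sum.cong simp: z_def)
    then have "z \<in> slice I n" "comb z = comb y"
      using y by (auto simp: slice_def G_def z_def)
    then show ?thesis by (metis image_eqI)
  qed
  then show "comb ` slice I n =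
      comb ` {y. (\<forall>i\<in>I. 0 \<le> y i) \<and> coord_sum y = real n} \<inter> int_lattice"
    by (auto simp: slice_def G_def)
qed

lemma finite_slice: "finite (slice J n)"
proof -
  have "bounded ((\<lambda>x. real n *\<^sub>R x) ` (convex hull (v ` I)))"
    by (intro bounded_scaling bounded_convex_hull finite_imp_bounded) auto
  then have "finite (slice I n)"
    using bij_betw_finite[OF bij_betw_slice] finite_int_lattice_Int by blast
  then show ?thesis
    by (rule rev_finite_subset) (auto simp: slice_def)
qed

section \<open>The Ehrhart series and the h*-polynomial\<close>

definition slice_series :: "'i set \<Rightarrow> real fps" where
  "slice_series J = Abs_fps (\<lambda>n. real (card (slice J n)))"

lemma ehrhart_series_eq: "ehrhart_series (convex hull (v ` I)) = slice_series I"
  unfolding ehrhart_series_def slice_series_def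
  using bij_betw_same_card[OF bij_betw_slice] by simp

lemma coord_sum_upd: "i \<in> I \<Longrightarrow> coord_sum (y(i := a)) = coord_sum y - y i + a"
proof -
  assume "i \<in> I"
  then have "coord_sum (y(i := a)) = a + (\<Sum>j\<in>I - {i}. y j)" "coord_sum y = y i + (\<Sum>j\<in>I - {i}. y j)"
    by (auto simp: coord_sum_def sum.remove[of I i] intro!: sum.cong)
  then show ?thesis by simp
qed

lemma slice_insert:
  assumes i: "i \<in> I - J"
  shows "slice (insert i J) n = slice J n \<union>
    (if n = 0 then {} else (\<lambda>y. y(i := y i + 1)) ` slice (insert i J) (n - 1))" (is "?L = _ \<union> ?R")
proof -
  have upd: "y(i := y i + a) \<in> G" if "y \<in> G" "a \<in> \<int>" for y a
    by (rule G_cong_mod_1[OF that(1)]) (use that(2) in auto)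
  have "slice J n \<subseteq> ?L" by (auto simp: slice_def)
  moreover have "?R \<subseteq> ?L"
    using i upd by (auto simp: slice_def coord_sum_upd split: if_splits)
  moreover have "y \<in> ?R" if y: "y \<in> ?L" "y \<notin> slice J n" for y
  proof -
    have yi: "y i \<ge> 1" using y i by (auto simp: slice_def)
    \<comment> \<open>Hence \<open>1 \<le> n\<close>, so that \<open>n - 1\<close> is not
      truncated.\<close>
    have "y i \<le> coord_sum y"
      unfolding coord_sum_def using y i by (intro member_le_sum) (auto simp: slice_def)
    then have "n \<noteq> 0" using y yi by (auto simp: slice_def)
    moreover have "y(i := y i + - 1) \<in> slice (insert i J) (n - 1)"
      using y yi i upd[of y "-1"] \<open>n \<noteq> 0\<close> by (auto simp: slice_def coord_sum_upd)
    ultimately show ?thesis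
      by (auto intro!: image_eqI[of _ _ "y(i := y i + - 1)"])
  qed
  ultimately show ?thesis by blast
qed

text \<open>The union is disjoint: coordinate \<open>i\<close> is below 1 in the first part and at
  least 1 in the shifted part.\<close>

lemma card_slice_insert:
  assumes i: "i \<in> I - J"
  shows "card (slice (insert i J) n) =
    card (slice J n) + (if n = 0 then 0 else card (slice (insert i J) (n - 1)))"
proof -
  have "inj_on (\<lambda>y. y(i := y i + 1)) A" for A :: "('i \<Rightarrow> real) set"
    by (rule inj_on_inverseI[of _ "\<lambda>y. y(i := y i - 1)"]) simp
  then have 1: "card ((\<lambda>y. y(i := y i + 1)) ` A) = card A" for A :: "('i \<Rightarrow> real) set"
    by (rule card_image)
  have 2: "slice J n \<inter> (\<lambda>y. y(i := y i + 1)) ` slice (insert i J) m = {}" for m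
  proof -
    have "y i < 1" if "y \<in> slice J n" for y
      using that i by (simp add: slice_def)
    moreover have "1 \<le> y i" if "y \<in> (\<lambda>y. y(i := y i + 1)) ` slice (insert i J) m" for y
      using that i by (auto simp: slice_def)
    ultimately show ?thesis by (meson disjoint_iff not_le)
  qed
  show ?thesis
    by (subst slice_insert[OF i, of n]) (simp add: 1 2 finite_slice card_Un_disjoint)
qed

lemma slice_series_insert:
  assumes "i \<in> I - J"
  shows "slice_series J = (1 - fps_X) * slice_series (insert i J)"
proof (rule fps_ext)
  fix n
  show "slice_series J $ n = ((1 - fps_X) * slice_series (insert i J)) $ n"
    unfolding slice_series_def left_diff_distrib fps_sub_nth fps_X_mult_nth mult_1 fps_nth_Abs_fps
    by (subst card_slice_insert[OF assms, of n]) simp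
qed

lemma slice_series_empty:
  assumes "J \<subseteq> I"
  shows "slice_series {} = (1 - fps_X) ^ card J * slice_series J"
  using finite_subset[OF assms finite_I] assms
proof (induction J rule: finite_induct)
  case (insert i J)
  have "slice_series {} = (1 - fps_X) ^ card J * slice_series J"
    using insert by simp
  also have "slice_series J = (1 - fps_X) * slice_series (insert i J)"
    by (rule slice_series_insert) (use insert in auto)
  finally show ?case using insert.hyps by (simp add: mult.assoc)
qed simp

lemma slice_empty_eq_empty:
  assumes "n > CARD('n)"
  shows "slice {} n = {}"
proof -
  have False if "y \<in> slice {} n" for y
  proof -
    have "coord_sum y < (\<Sum>i\<in>I. 1)"
      unfolding coord_sum_def using that by (intro sum_strict_mono) (use card_I in \<open>auto simp: slice_def\<close>)
    then show False using that assms by (simp add: slice_def card_I)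
  qed
  then show ?thesis by blast
qed

text \<open>Coefficient \<open>n\<close> counts the lattice points at height \<open>n\<close> in the
  half-open parallelepiped spanned by the vertices placed at height 1.\<close>

definition box_poly :: "real poly" where
  "box_poly = (\<Sum>n\<le>CARD('n). monom (real (card (slice {} n))) n)"

lemma coeff_box_poly: "coeff box_poly n = real (card (slice {} n))"
  by (auto simp: box_poly_def coeff_sum slice_empty_eq_empty)

lemma hstar_poly_eq: "hstar_poly (convex hull (v ` I)) = box_poly"
proof -
  have "aff_dim (convex hull (v ` I)) = int CARD('n)"
    using aff_dim_affine_independent[OF indep_v]
    by (simp add: aff_dim_convex_hull card_image[OF inj_v] card_I)
  \<comment> \<open>The equivalence gives existence and uniqueness at once, as required by the
    definite description in \<open>hstar_poly\<close>.\<close>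
  moreover have "slice_series I = fps_of_poly h / (1 - fps_X) ^ (CARD('n) + 1) \<longleftrightarrow> h = box_poly" for h
  proof -
    define u :: "real fps" where "u = (1 - fps_X) ^ (CARD('n) + 1)"
    have u: "u $ 0 \<noteq> 0" by (simp add: u_def fps_nth_power_0)
    have "fps_of_poly box_poly = slice_series {}"
      by (rule fps_ext) (simp add: coeff_box_poly slice_series_def)
    also have "\<dots> = u * slice_series I"
      using slice_series_empty[OF order.refl] by (simp add: u_def card_I)
    finally have eq: "fps_of_poly box_poly = u * slice_series I" .
    have "slice_series I = fps_of_poly h / u \<longleftrightarrow> u * slice_series I = fps_of_poly h"
    proof
      show "u * slice_series I = fps_of_poly h" if "slice_series I = fps_of_poly h / u"
        using u that by (simp add: fps_divide_unit mult.left_commute[of u] inverse_mult_eq_1')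
      show "slice_series I = fps_of_poly h / u" if "u * slice_series I = fps_of_poly h"
        using u by (simp add: fps_divide_unit mult.assoc[symmetric] mult.commute[of _ "inverse u"]
            inverse_mult_eq_1 flip: that)
    qed
    also have "\<dots> \<longleftrightarrow> h = box_poly"
      by (auto simp: eq[symmetric] fps_of_poly_eq_iff)
    finally show ?thesis by (simp add: u_def)
  qed
  ultimately show ?thesis
    by (simp add: hstar_poly_def ehrhart_series_eq del: power_Suc)
qed

text \<open>The fractional parts of \<open>y i\<close> and \<open>- y i\<close> add up to 1 if
  \<open>y i\<close> is not an integer and to 0 otherwise. So the weight is the total height of two
  box points, each of height at most the degree.\<close>

lemma card_nonint_le:
  assumes "polytope_degree (convex hull (v ` I)) = s" "y \<in> G"
  shows "card (nonint I y) \<le> 2 * s"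
proof -
  define r where "r z i = (if i \<in> I then frac (z i) else 0 :: real)" for z i
  have total_r: "coord_sum (r z) \<le> real s" if z: "z \<in> G" for z
  proof -
    have "r z \<in> G"
      by (rule G_cong_mod_1[OF z]) (simp add: r_def frac_def)
    moreover have "coord_sum (r z) \<ge> 0"
      unfolding coord_sum_def by (intro sum_nonneg) (simp add: r_def)
    ultimately obtain n where n: "coord_sum (r z) = real n"
      unfolding G_def by (auto elim!: Ints_cases) (metis of_int_of_nat_eq zero_le_imp_eq_int)
    with \<open>r z \<in> G\<close> have "r z \<in> slice {} n"
      by (auto simp: slice_def r_def frac_lt_1)
    \<comment> \<open>A box point at height \<open>n\<close> makes this coefficient
      positive.\<close>
    then have "coeff box_poly n \<noteq> 0"
      using finite_slice by (auto simp: coeff_box_poly)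
    then have "n \<le> s"
      using le_degree[of box_poly n] assms(1) by (simp add: polytope_degree_def hstar_poly_eq)
    with n show ?thesis by simp
  qed
  have "(\<lambda>i. - y i) \<in> G"
    using real_fun_subgroup_diff[OF subgroup_G real_fun_subgroup_zero[OF subgroup_G] assms(2)] by simp
  have "real (card (nonint I y)) = (\<Sum>i\<in>I. of_bool (y i \<notin> \<int>))"
    by (simp add: nonint_def of_bool_def sum.If_cases Int_def)
  also have "\<dots> = (\<Sum>i\<in>I. r y i + r (\<lambda>i. - y i) i)"
    by (intro sum.cong) (auto simp: r_def frac_neg)
  also have "\<dots> = coord_sum (r y) + coord_sum (r (\<lambda>i. - y i))"
    by (simp add: coord_sum_def sum.distrib)
  also have "\<dots> \<le> real (2 * s)"
    using total_r[OF assms(2)] total_r[OF \<open>(\<lambda>i. - y i) \<in> G\<close>] by simp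
  finally show ?thesis by linarith
qed

section \<open>Lattice pyramids from an always integral coordinate\<close>

text \<open>The barycentric coordinate of vertex \<open>i\<close> is an affine function, here
  integral on the lattice. It is 1 at \<open>v i\<close> and 0 at the other vertices, so it can
  serve as the height of a pyramid after a unimodular change of coordinates.\<close>

lemma lattice_pyramidI:
  assumes "i \<in> I" and int: "\<And>y. y \<in> G \<Longrightarrow> y i \<in> \<int>"
  shows "lattice_pyramid (convex hull (v ` I))"
proof -
  have G: "y i \<in> \<int>" if "comb y \<in> int_lattice" "coord_sum y = 1" for y
    using that int by (simp add: G_def)
  obtain y0 where y0: "comb y0 = 0" "coord_sum y0 = 1" using ex_comb by blast
  have "\<exists>z. \<forall>m. comb (z m) = axis m 1 \<and> coord_sum (z m) = 1"
    by (rule choice) (use ex_comb in blast)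
  then obtain z where z: "comb (z m) = axis m 1" "coord_sum (z m) = 1" for m
    by blast
  \<comment> \<open>\<open>y0\<close> and \<open>z m\<close> are the barycentric coordinates of the
    origin and the unit vectors, so \<open>c\<close> is the linear part of that affine function and
    \<open>y0 i\<close> its constant term.\<close>
  define c :: "int ^ 'n" where "c = (\<chi> m. \<lfloor>z m i - y0 i\<rfloor>)"
  have "z m i - y0 i \<in> \<int>" for m
    using G[OF _ z(2)] G[OF _ y0(2)] by (simp add: z y0 int_lattice_def axis_def)
  then have c: "real_of_int (c $ m) = z m i - y0 i" for m
    by (simp add: c_def)
  define height where "height x = (\<Sum>m\<in>UNIV. real_of_int (c $ m) * x $ m)" for x :: "real ^ 'n"
  have height_v: "y0 i + height (v j) = of_bool (i = j)" if "j \<in> I" for j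
  proof -
    \<comment> \<open>These are the barycentric coordinates of \<open>v j\<close> obtained by affine
      extension; by uniqueness they agree with the unit tuple at \<open>j\<close>.\<close>
    define y where "y l = y0 l + (\<Sum>m\<in>UNIV. v j $ m * (z m l - y0 l))" for l
    have "coord_sum y = coord_sum y0 + (\<Sum>m\<in>UNIV. v j $ m * coord_sum (\<lambda>l. z m l - y0 l))"
      unfolding coord_sum_def y_def sum.distrib sum_distrib_left by (subst sum.swap) simp
    then have 1: "coord_sum y = 1" by (simp add: coord_sum_diff z y0)
    have "comb y = comb y0 + (\<Sum>m\<in>UNIV. v j $ m *\<^sub>R comb (\<lambda>l. z m l - y0 l))"
      unfolding comb_def y_def scaleR_left_distrib sum.distrib scaleR_sum_left scaleR_sum_right
      by (subst sum.swap) simp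
    also have "\<dots> = v j"
      by (simp add: comb_diff z y0 vec_eq_iff axis_def if_distrib[of "(*) x" for x] cong: if_cong)
    finally have "comb y = comb (\<lambda>l. of_bool (l = j))"
      using that by (simp add: comb_def of_bool_def if_distrib[of "\<lambda>a. a *\<^sub>R x" for x] cong: if_cong)
    moreover have "coord_sum y = coord_sum (\<lambda>l. of_bool (l = j))"
      using that 1 by (simp add: coord_sum_def of_bool_def)
    ultimately have "y i = of_bool (i = j)" using comb_eqD assms(1) by blast
    then show ?thesis by (simp add: y_def height_def c mult.commute)
  qed
  have "I - {i} \<noteq> {}"
  proof
    assume "I - {i} = {}"
    then have "card I \<le> card {i}" by (intro card_mono) auto
    then show False using card_I by simp
  qed
  then obtain j where j: "j \<in> I" "j \<noteq> i" by auto
  \<comment> \<open>\<open>c\<close> takes the value 1 on the lattice vector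
    \<open>v i - v j\<close>, so a common divisor of its entries divides 1.\<close>
  have "\<bar>d\<bar> = 1" if d: "\<And>m. d dvd c $ m" for d
  proof -
    have "v i - v j \<in> int_lattice" using assms(1) j integral_v by (intro int_lattice_diff) auto
    then have "v i $ m - v j $ m = real_of_int \<lfloor>v i $ m - v j $ m\<rfloor>" for m
      by (simp add: int_lattice_def)
    then have "real_of_int (\<Sum>m\<in>UNIV. c $ m * \<lfloor>v i $ m - v j $ m\<rfloor>) =
        (\<Sum>m\<in>UNIV. real_of_int (c $ m) * (v i $ m - v j $ m))" by simp
    also have "\<dots> = height (v i) - height (v j)"
      by (simp add: height_def right_diff_distrib sum_subtractf)
    also have "\<dots> = 1" using height_v[of i] height_v[of j] assms(1) j by simp
    finally have "(\<Sum>m\<in>UNIV. c $ m * \<lfloor>v i $ m - v j $ m\<rfloor>) = 1" by linarith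
    moreover have "d dvd (\<Sum>m\<in>UNIV. c $ m * \<lfloor>v i $ m - v j $ m\<rfloor>)"
      using d by (intro dvd_sum) auto
    ultimately show ?thesis by (simp add: zdvd1_eq)
  qed
  then obtain k and A :: "int ^ 'n ^ 'n" where A: "invertible A" "A $ k = c"
    using unimodular_completion by blast
  define L where "L x = map_matrix real_of_int A *v x" for x
  have L_k: "L x $ k = height x" for x
    by (simp add: L_def height_def matrix_vector_mult_def map_matrix_def A)
  have L_int: "L x \<in> int_lattice" if "x \<in> int_lattice" for x
    using that unfolding L_def int_lattice_def
    by (auto simp: matrix_vector_mult_def map_matrix_def intro!: Ints_sum Ints_mult)
  have "linear L" unfolding L_def by (rule matrix_vector_mul_linear)
  \<comment> \<open>The translation sends \<open>v i\<close> to the apex; the remaining vertices,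
    one unit lower, land in the hyperplane of height 0.\<close>
  define u where "u = axis k 1 - L (v i)"
  have u: "u \<in> int_lattice"
    unfolding u_def using assms(1) integral_v
    by (intro int_lattice_diff L_int) (auto simp: int_lattice_def axis_def)
  define f where "f x = L x + u" for x
  have f_int: "f x \<in> int_lattice" if "x \<in> int_lattice" for x
    unfolding f_def using that u L_int by (intro int_lattice_add) auto
  have f_i: "f (v i) = axis k 1" by (simp add: f_def u_def)
  have f_j: "f (v j) $ k = 0" if "j \<in> I - {i}" for j
  proof -
    have "y0 i + height (v i) = 1" "y0 i + height (v j) = 0"
      using height_v assms(1) that by auto
    then show ?thesis by (simp add: f_def u_def L_k)
  qed
  define Q where "Q = convex hull (f ` v ` (I - {i}))"
  have "f ` (convex hull (v ` I)) = (+) u ` L ` (convex hull (v ` I))"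
    by (simp add: image_image f_def add.commute)
  also have "\<dots> = convex hull ((+) u ` L ` v ` I)"
    using \<open>linear L\<close> by (simp add: convex_hull_translation convex_hull_linear_image)
  also have "(+) u ` L ` v ` I = f ` v ` (I - {i}) \<union> {axis k 1}"
  proof -
    have "(+) u ` L ` v ` I = f ` v ` insert i (I - {i})"
      using assms(1) by (simp only: image_image f_def add.commute insert_Diff)
    then show ?thesis by (simp only: image_insert f_i Un_insert_right Un_empty_right)
  qed
  also have "convex hull \<dots> = convex hull (Q \<union> {axis k 1})"
    unfolding Q_def by (rule hull_Un_left)
  finally have image: "convex hull (Q \<union> {axis k 1}) = f ` (convex hull (v ` I))" ..
  have "lattice_polytope Q"
    unfolding lattice_polytope_def
  proof
    show "polytope Q" unfolding Q_def by (rule polytope_convex_hull) auto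
    show "{x. x extreme_point_of Q} \<subseteq> int_lattice"
      unfolding Q_def using f_int integral_v by (auto dest!: extreme_point_of_convex_hull)
  qed
  moreover have "Q \<subseteq> {x. x $ k = 0}"
    unfolding Q_def by (rule hull_minimal) (use f_j in \<open>auto simp: convex_def\<close>)
  moreover have "unimodularly_equivalent (convex hull (v ` I)) (convex hull (Q \<union> {axis k 1}))"
    unfolding unimodularly_equivalent_def
  proof (intro exI conjI)
    show "convex hull (Q \<union> {axis k 1}) =
        (\<lambda>x. map_matrix real_of_int A *v x + u) ` (convex hull (v ` I))"
      unfolding image f_def L_def ..
  qed (use A u in auto)
  ultimately show ?thesis unfolding lattice_pyramid_def by blast
qed

end

section \<open>Simplices of extremal dimension\<close>

theorem theorem1p4:
  fixes s :: nat and \<Delta> :: "(real ^ 'n) set" and v :: "nat \<Rightarrow> real ^ 'n"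
  assumes "s > 0"
    and "CARD('n) = floor_sum (2 * s) - 1"
    and "int (floor_sum (2 * s) - 1) simplex \<Delta>"
    and "lattice_polytope \<Delta>"
    and "polytope_degree \<Delta> = s"
    and "\<not> lattice_pyramid \<Delta>"
    and "bij_betw v {1..floor_sum (2 * s)} {x. x extreme_point_of \<Delta>}"
  shows "Lambda v \<subseteq> {1..floor_sum (2 * s)} \<rightarrow>\<^sub>E {mod_int 0, mod_int (1/2)}"
proof
  fix x assume "x \<in> Lambda v"
  define N where "N = floor_sum (2 * s)"
  \<comment> \<open>Positivity ensures that the subtraction in \<open>N - 1\<close> is not
    truncated.\<close>
  have "N > 0" using floor_sum_rec[of "2 * s"] assms(1) by (simp add: N_def)
  then have N: "CARD('n) + 1 = N" using assms(2) by (simp add: N_def)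
  obtain C where C: "\<not> affine_dependent C" "int (card C) = int (N - 1) + 1" "\<Delta> = convex hull C"
    using assms(3) by (auto simp: simplex_def N_def)
  have "{x. x extreme_point_of \<Delta>} = C"
    using C by (simp add: extreme_point_of_convex_hull_affine_independent)
  then have bij: "bij_betw v {1..N} C" and "C \<subseteq> int_lattice"
    using assms(4,7) by (auto simp: lattice_polytope_def N_def)
  then have C_eq: "C = v ` {1..N}" by (simp add: bij_betw_def)
  interpret lattice_simplex v "{1..N}"
    using bij C(1) \<open>C \<subseteq> int_lattice\<close> N by unfold_locales (auto simp: bij_betw_def)
  from \<open>x \<in> Lambda v\<close> obtain y where x: "x \<in> {1..N} \<rightarrow>\<^sub>E UNIV"
    and y: "\<And>i. i \<in> {1..N} \<Longrightarrow> x i = mod_int (y i)" and "y \<in> G"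
    unfolding Lambda_def N G_def comb_def coord_sum_def by blast
  have "x i \<in> {mod_int 0, mod_int (1/2)}" if i: "i \<in> {1..N}" for i
  proof -
    have "2 * y i \<in> \<int>"
    proof (rule extremal_half_integral[where G = G and M = "2 * s"])
      show "card (nonint {1..N} z) \<le> 2 * s" if "z \<in> G" for z
        using card_nonint_le[OF _ that] assms(5) C(3) C_eq by simp
      \<comment> \<open>Otherwise coordinate \<open>j\<close> would be integral on all of
        \<open>G\<close>, and the simplex would be a pyramid with apex \<open>v j\<close>.\<close>
      show "\<exists>z\<in>G. z j \<notin> \<int>" if "j \<in> {1..N}" for j
        using lattice_pyramidI[OF that] assms(6) C(3) C_eq by auto
    qed (use subgroup_G \<open>y \<in> G\<close> i in \<open>auto simp: N_def\<close>)
    then obtain k where k: "2 * y i = of_int k" by (auto elim: Ints_cases)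
    have "y i - 0 \<in> \<int> \<or> y i - 1/2 \<in> \<int>"
    proof (cases "even k")
      case True
      then obtain l where "k = 2 * l" by (elim evenE)
      with k have "y i = of_int l" by simp
      then show ?thesis by simp
    next
      case False
      then obtain l where "k = 2 * l + 1" by (elim oddE)
      with k have "y i - 1/2 = of_int l" by simp
      then show ?thesis by (metis Ints_of_int)
    qed
    then show ?thesis
      using y[OF i] by (auto simp: real_mod_int.abs_eq_iff)
  qed
  with x show "x \<in> {1..floor_sum (2 * s)} \<rightarrow>\<^sub>E {mod_int 0, mod_int (1/2)}"
    by (auto simp: PiE_iff N_def)
qed

end
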